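(* Let $K$ be a compact hyperbolic attractor of a smooth diffeomorphism $f$ of a smooth Riemannian manifold $\mathcal{M}$. There are $C>0$ and $0<\lambda<1$ such that for any $x\in K$, $\eta\in T^*_x\mathcal{M}$ and $n\ge0$, $$|{f^*}^{-n}\mathcal{P}^u\eta|\le C\lambda^n|\mathcal{P}^u\eta|,\qquad|{f^*}^{n}\mathcal{P}^s\eta|\le C\lambda^n|\mathcal{P}^s\eta| .$$
   Context: $K$ is a compact hyperbolic set: $T_K\mathcal{M}$ has a continuous $f_*$-invariant splitting $T_K\mathcal{M}=V^s\oplus V^u$ and there are $C>0$, $0<\lambda<1$ with $|f_*^{-n}|_{V^u(x)}|,\ |f_*^{n}|_{V^s(x)}|\le C\lambda^n$ for all $x\in K$, $n\ge0$, where $f_*$ is the pushforward (differential). $K$ is an attractor: there is an open neighborhood $U$ of $K$ with $\bigcap_{n\ge0}f^nU=K$. $P^s,P^u$ are the projections onto $V^s,V^u$ along the splitting. The pullback $f^*:T^*_{fx}\mathcal{M}\to T^*_x\mathcal{M}$ is the adjoint of $f_*$: $(f^*\eta)(w)=\eta(f_*w)$; ${f^*}^{n}$ takes covectors at $x$ to covectors at $f^{-n}x$ for $n\in\mathbb{Z}$. The adjoint projections on covectors are $(\mathcal{P}^u\eta)(w)=\eta(P^uw)$, $(\mathcal{P}^s\eta)(w)=\eta(P^sw)$. The norm of a covector is $|\eta|=\sup_{w\neq0}\eta(w)/|w|$. *)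

theory Defs
  imports "HOL-Analysis.Analysis"
begin

subsection \<open>Smooth maps between Euclidean spaces\<close>

text \<open>Only meant for open \<open>S\<close>: the derivatives are taken with respect to the whole space.\<close>

fun Ck_on :: "nat \<Rightarrow> 'a::euclidean_space set \<Rightarrow> ('a \<Rightarrow> 'b::real_normed_vector) \<Rightarrow> bool" where
  "Ck_on 0 S h \<longleftrightarrow> continuous_on S h"
| "Ck_on (Suc k) S h \<longleftrightarrow>
     (\<forall>x\<in>S. h differentiable at x) \<and> (\<forall>v. Ck_on k S (\<lambda>x. frechet_derivative h (at x) v))"

definition smooth_on :: "'a::euclidean_space set \<Rightarrow> ('a \<Rightarrow> 'b::real_normed_vector) \<Rightarrow> bool" where
  "smooth_on S h \<longleftrightarrow> (\<forall>k. Ck_on k S h)"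


subsection \<open>Smooth manifolds\<close>

text \<open>The manifold is the whole type \<open>'m\<close>, whose topology is Hausdorff and second countable
  by its type classes; it is modelled on the Euclidean space \<open>'e\<close>.\<close>

record ('m, 'e) chart =
  chart_dom :: "'m set"
  chart_map :: "'m \<Rightarrow> 'e"

definition chart_image :: "('m, 'e) chart \<Rightarrow> 'e set" where
  "chart_image c = chart_map c ` chart_dom c"

definition chart_inv :: "('m, 'e) chart \<Rightarrow> 'e \<Rightarrow> 'm" where
  "chart_inv c = inv_into (chart_dom c) (chart_map c)"

definition is_chart ::
    "('m::{t2_space, second_countable_topology}, 'e::euclidean_space) chart \<Rightarrow> bool" where
  "is_chart c \<longleftrightarrow> open (chart_dom c) \<and> open (chart_image c) \<and>
     homeomorphism (chart_dom c) (chart_image c) (chart_map c) (chart_inv c)"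

definition smooth_atlas ::
    "('m::{t2_space, second_countable_topology}, 'e::euclidean_space) chart set \<Rightarrow> bool" where
  "smooth_atlas A \<longleftrightarrow> (\<forall>c\<in>A. is_chart c) \<and> (\<Union>c\<in>A. chart_dom c) = UNIV \<and>
     (\<forall>c\<in>A. \<forall>d\<in>A. smooth_on (chart_map c ` (chart_dom c \<inter> chart_dom d)) (chart_map d \<circ> chart_inv c))"

definition smooth_map ::
    "('m::{t2_space, second_countable_topology}, 'e::euclidean_space) chart set \<Rightarrow> ('m \<Rightarrow> 'm) \<Rightarrow> bool" where
  "smooth_map A f \<longleftrightarrow> continuous_on UNIV f \<and>
     (\<forall>c\<in>A. \<forall>d\<in>A. smooth_on (chart_map c ` (chart_dom c \<inter> f -` chart_dom d))
                        (chart_map d \<circ> f \<circ> chart_inv c))"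

definition smooth_diffeo ::
    "('m::{t2_space, second_countable_topology}, 'e::euclidean_space) chart set \<Rightarrow> ('m \<Rightarrow> 'm) \<Rightarrow> bool" where
  "smooth_diffeo A f \<longleftrightarrow> bij f \<and> smooth_map A f \<and> smooth_map A (inv f)"


subsection \<open>Tangent and cotangent bundle\<close>

text \<open>Each point \<open>x\<close> gets a preferred chart \<open>chart_at A x\<close>, and the tangent space at \<open>x\<close> is the
  vector space \<open>'e\<close>: a tangent vector is given by its coordinates in the preferred chart.
  The preferred chart may jump from point to point, so continuity and smoothness of fields
  on \<open>'m\<close> are always expressed after a change of coordinates to a fixed chart
  with \<open>coord_change\<close>.

  A point of the tangent bundle is a pair \<open>(x, v)\<close>; a point of the cotangent bundle is a pair
  \<open>(x, \<eta>)\<close> with \<open>\<eta> :: 'e \<Rightarrow> real\<close> linear.\<close>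

definition chart_at :: "('m, 'e) chart set \<Rightarrow> 'm \<Rightarrow> ('m, 'e) chart" where
  "chart_at A x = (SOME c. c \<in> A \<and> x \<in> chart_dom c)"

definition coord_change ::
    "('m, 'e::euclidean_space) chart \<Rightarrow> ('m, 'e) chart \<Rightarrow> 'm \<Rightarrow> 'e \<Rightarrow> 'e" where
  "coord_change c d x = frechet_derivative (chart_map d \<circ> chart_inv c) (at (chart_map c x))"

definition differential ::
    "('m, 'e::euclidean_space) chart set \<Rightarrow> ('m \<Rightarrow> 'm) \<Rightarrow> 'm \<Rightarrow> 'e \<Rightarrow> 'e" where
  "differential A f x =
     frechet_derivative (chart_map (chart_at A (f x)) \<circ> f \<circ> chart_inv (chart_at A x))
       (at (chart_map (chart_at A x) x))"

definition pushforward ::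
    "('m, 'e::euclidean_space) chart set \<Rightarrow> ('m \<Rightarrow> 'm) \<Rightarrow> 'm \<times> 'e \<Rightarrow> 'm \<times> 'e" where
  "pushforward A f = (\<lambda>(x, v). (f x, differential A f x v))"

text \<open>The map \<open>f\<^sup>*\<close> from covectors at \<open>f x\<close> to covectors at \<open>x\<close>. For a diffeomorphism \<open>f\<close> both
  \<open>pushforward A f\<close> and \<open>pullback A f\<close> are bijections of the whole pair types (for the latter,
  because every \<open>differential A f x\<close> is a bijection of \<open>'e\<close>), and \<open>inv\<close> of the latter maps linear
  functionals to linear functionals. Hence \<open>inv (pushforward A f) ^^ n\<close> is \<open>f\<^sub>*\<close> to the power \<open>-n\<close>,
  and \<open>inv (pullback A f) ^^ n\<close> is \<open>f\<^sup>*\<close> to the power \<open>-n\<close>.\<close>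

definition pullback ::
    "('m, 'e::euclidean_space) chart set \<Rightarrow> ('m \<Rightarrow> 'm) \<Rightarrow> 'm \<times> ('e \<Rightarrow> real) \<Rightarrow> 'm \<times> ('e \<Rightarrow> real)" where
  "pullback A f = (\<lambda>(y, \<eta>). (inv f y, \<eta> \<circ> differential A f (inv f y)))"


subsection \<open>Riemannian metrics\<close>

definition riemannian_metric ::
    "('m::{t2_space, second_countable_topology}, 'e::euclidean_space) chart set
      \<Rightarrow> ('m \<Rightarrow> 'e \<Rightarrow> 'e \<Rightarrow> real) \<Rightarrow> bool" where
  "riemannian_metric A g \<longleftrightarrow>
     (\<forall>x. bilinear (g x) \<and> (\<forall>v w. g x v w = g x w v) \<and> (\<forall>v. v \<noteq> 0 \<longrightarrow> g x v v > 0)) \<and>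
     (\<forall>c\<in>A. \<forall>a b. smooth_on (chart_image c)
        (\<lambda>p. let x = chart_inv c p; d = chart_at A x
             in g x (coord_change c d x a) (coord_change c d x b)))"

definition tnorm :: "('m \<Rightarrow> 'e \<Rightarrow> 'e \<Rightarrow> real) \<Rightarrow> 'm \<times> 'e \<Rightarrow> real" where
  "tnorm g = (\<lambda>(x, v). sqrt (g x v v))"

definition conorm ::
    "('m \<Rightarrow> 'e::euclidean_space \<Rightarrow> 'e \<Rightarrow> real) \<Rightarrow> 'm \<times> ('e \<Rightarrow> real) \<Rightarrow> real" where
  "conorm g = (\<lambda>(x, \<eta>). SUP w\<in>-{0}. \<eta> w / tnorm g (x, w))"

text \<open>Operator norm of a bundle map restricted to the subspace \<open>V\<close> of the tangent space at \<open>x\<close>.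
  As in \<^const>\<open>onorm\<close>, the zero vector contributes \<open>0 / 0 = 0\<close>.\<close>

definition restr_onorm ::
    "('m \<Rightarrow> 'e \<Rightarrow> 'e \<Rightarrow> real) \<Rightarrow> ('m \<times> 'e \<Rightarrow> 'm \<times> 'e) \<Rightarrow> 'm \<Rightarrow> 'e set \<Rightarrow> real" where
  "restr_onorm g T x V = (SUP v\<in>V. tnorm g (T (x, v)) / tnorm g (x, v))"


subsection \<open>Hyperbolic attractors\<close>

definition continuous_section ::
    "('m::{t2_space, second_countable_topology}, 'e::euclidean_space) chart set
      \<Rightarrow> 'm set \<Rightarrow> ('m \<Rightarrow> 'e) \<Rightarrow> bool" where
  "continuous_section A S e \<longleftrightarrow>
     (\<forall>c\<in>A. continuous_on (S \<inter> chart_dom c) (\<lambda>x. coord_change (chart_at A x) c x (e x)))"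

text \<open>Continuous vector subbundles of the restriction of the tangent bundle to \<open>K\<close>, through local
  continuous frames. The rank \<open>k\<close> need only be locally constant.\<close>

definition continuous_subbundle ::
    "('m::{t2_space, second_countable_topology}, 'e::euclidean_space) chart set
      \<Rightarrow> 'm set \<Rightarrow> ('m \<Rightarrow> 'e set) \<Rightarrow> bool" where
  "continuous_subbundle A K V \<longleftrightarrow>
     (\<forall>x\<in>K. \<exists>W (k::nat) e. open W \<and> x \<in> W \<and>
        (\<forall>i<k. continuous_section A (K \<inter> W) (e i)) \<and>
        (\<forall>y\<in>K \<inter> W. inj_on (\<lambda>i. e i y) {..<k} \<and> independent ((\<lambda>i. e i y) ` {..<k}) \<and>
                    V y = span ((\<lambda>i. e i y) ` {..<k})))"

definition direct_sum :: "'e::real_vector set \<Rightarrow> 'e set \<Rightarrow> bool" where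
  "direct_sum V W \<longleftrightarrow> subspace V \<and> subspace W \<and> V \<inter> W = {0} \<and> {v + w |v w. v \<in> V \<and> w \<in> W} = UNIV"

definition proj_along :: "'e::real_vector set \<Rightarrow> 'e set \<Rightarrow> 'e \<Rightarrow> 'e" where
  "proj_along V W w = (THE v. v \<in> V \<and> w - v \<in> W)"

text \<open>Invariance of the splitting of the restricted tangent bundle presupposes \<open>f ` K = K\<close>.\<close>

definition hyperbolic_splitting ::
    "('m::{t2_space, second_countable_topology}, 'e::euclidean_space) chart set
      \<Rightarrow> ('m \<Rightarrow> 'e \<Rightarrow> 'e \<Rightarrow> real) \<Rightarrow> ('m \<Rightarrow> 'm) \<Rightarrow> 'm set
      \<Rightarrow> ('m \<Rightarrow> 'e set) \<Rightarrow> ('m \<Rightarrow> 'e set) \<Rightarrow> bool" where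
  "hyperbolic_splitting A g f K Vs Vu \<longleftrightarrow>
     f ` K = K \<and>
     continuous_subbundle A K Vs \<and> continuous_subbundle A K Vu \<and>
     (\<forall>x\<in>K. direct_sum (Vs x) (Vu x)) \<and>
     (\<forall>x\<in>K. differential A f x ` Vs x = Vs (f x) \<and> differential A f x ` Vu x = Vu (f x)) \<and>
     (\<exists>C l. C > 0 \<and> 0 < l \<and> l < 1 \<and>
        (\<forall>x\<in>K. \<forall>n. restr_onorm g (inv (pushforward A f) ^^ n) x (Vu x) \<le> C * l ^ n \<and>
                   restr_onorm g (pushforward A f ^^ n) x (Vs x) \<le> C * l ^ n))"

definition attractor :: "('m::topological_space \<Rightarrow> 'm) \<Rightarrow> 'm set \<Rightarrow> bool" where
  "attractor f K \<longleftrightarrow> (\<exists>U. open U \<and> K \<subseteq> U \<and> (\<Inter>n. (f ^^ n) ` U) = K)"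

text \<open>Adjoint of a family of endomorphisms of the tangent spaces. The adjoint projections are
  \<open>adjoint_at (\<lambda>x. proj_along (Vu x) (Vs x))\<close> and \<open>adjoint_at (\<lambda>x. proj_along (Vs x) (Vu x))\<close>.\<close>

definition adjoint_at :: "('m \<Rightarrow> 'e \<Rightarrow> 'e) \<Rightarrow> 'm \<times> ('e \<Rightarrow> real) \<Rightarrow> 'm \<times> ('e \<Rightarrow> real)" where
  "adjoint_at P = (\<lambda>(x, \<eta>). (x, \<eta> \<circ> P x))"

end

theory Submission
  imports Defs
begin

text \<open>By invariance of the splitting, the iterated pullback of a covector that factors through one
  of the projections is that covector evaluated on the image, under the contracting iterate, of
  the corresponding component of the tangent vector. The norm of this component is at most a
  constant multiple of the norm of the vector, uniformly over \<open>K\<close>. That uniform bound is obtained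
  from the dynamics instead of the continuity of the subbundles: \<open>f\<^sub>*\<close> is bounded over the compact
  set \<open>K\<close>, while a long iterate expands the unstable component and contracts the stable one, so a
  short vector cannot have two long components that nearly cancel.\<close>

subsection \<open>Norms of tangent vectors and covectors\<close>

text \<open>Collects the pointwise algebra of the metric, with no regularity in \<open>x\<close>: a
  constant derived from a single fibre may depend on the base point.\<close>

locale fibre_metric =
  fixes g :: "'m \<Rightarrow> 'e::euclidean_space \<Rightarrow> 'e \<Rightarrow> real"
  assumes bilin: "bilinear (g x)"
    and sym: "g x v w = g x w v"
    and pos: "v \<noteq> 0 \<Longrightarrow> g x v v > 0"
begin

lemma g_simps:
  "g x (u + v) w = g x u w + g x v w" "g x w (u + v) = g x w u + g x w v"
  "g x (r *\<^sub>R u) w = r * g x u w" "g x w (r *\<^sub>R u) = r * g x w u"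
  "g x 0 w = 0" "g x w 0 = 0"
  using bilin[of x]
  by (simp_all add: bilinear_ladd bilinear_radd bilinear_lmul bilinear_rmul bilinear_lzero bilinear_rzero)

lemma g_nonneg: "0 \<le> g x v v"
  using pos[of v x] by (cases "v = 0") (auto simp: g_simps)

lemma tnorm_nonneg [simp]: "0 \<le> tnorm g (x, v)"
  by (simp add: tnorm_def g_nonneg)

lemma tnorm_zero [simp]: "tnorm g (x, 0) = 0"
  by (simp add: tnorm_def g_simps)

lemma tnorm_pos: "v \<noteq> 0 \<Longrightarrow> 0 < tnorm g (x, v)"
  by (simp add: tnorm_def pos)

lemma tnorm_power2: "(tnorm g (x, v))\<^sup>2 = g x v v"
  by (simp add: tnorm_def g_nonneg)

lemma tnorm_minus [simp]: "tnorm g (x, - v) = tnorm g (x, v)"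
  using g_simps(3)[of x "-1" v "- v"] g_simps(4)[of x v "-1" v] by (simp add: tnorm_def)

lemma cauchy_schwarz: "g x v w \<le> tnorm g (x, v) * tnorm g (x, w)"
proof (cases "v = 0 \<or> w = 0")
  case True
  then show ?thesis by (auto simp: g_simps)
next
  case False
  define a b where "a = tnorm g (x, v)" and "b = tnorm g (x, w)"
  have ab: "a > 0" "b > 0"
    using False by (auto simp: a_def b_def tnorm_pos)
  \<comment> \<open>Both summands have length \<open>a * b\<close>, so expanding
    \<open>g x ?u ?u\<close> leaves twice \<open>a * b\<close> times the gap in the desired
    inequality.\<close>
  let ?u = "b *\<^sub>R v + (- a) *\<^sub>R w"
  have "g x ?u ?u = b * (b * g x v v) - 2 * (a * (b * g x v w)) + a * (a * g x w w)"
    using sym[of x w v] by (simp only: g_simps) (simp add: algebra_simps)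
  also have "\<dots> = 2 * (a * b) * (a * b - g x v w)"
    unfolding tnorm_power2[symmetric] a_def[symmetric] b_def[symmetric]
    by (simp add: algebra_simps power2_eq_square)
  finally have "0 \<le> 2 * (a * b) * (a * b - g x v w)"
    using g_nonneg[of x ?u] by simp
  then show ?thesis
    using ab mult_pos_pos[OF ab] by (simp add: zero_le_mult_iff flip: a_def b_def)
qed

lemma tnorm_triangle: "tnorm g (x, v + w) \<le> tnorm g (x, v) + tnorm g (x, w)"
proof (rule power2_le_imp_le)
  show "(tnorm g (x, v + w))\<^sup>2 \<le> (tnorm g (x, v) + tnorm g (x, w))\<^sup>2"
    using cauchy_schwarz[of x v w] sym[of x w v]
    by (simp add: power2_sum tnorm_power2 g_simps)
qed simp

lemma tnorm_diff: "tnorm g (x, v) - tnorm g (x, w) \<le> tnorm g (x, v + w)"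
  using tnorm_triangle[of x "v + w" "- w"] by simp

end

text \<open>By homogeneity only unit vectors matter. Expansion in \<open>Basis\<close> turns
  continuity for each fixed pair of vectors into joint continuity on \<open>S\<close> times the unit
  sphere. The extrema over this compact set serve as \<open>m\<close> and \<open>M\<close>; they are
  positive because every value there is.\<close>

lemma form_bounds_on_compact:
  fixes G :: "'p::t2_space \<Rightarrow> 'e::euclidean_space \<Rightarrow> 'e \<Rightarrow> real"
  assumes "compact S" "S \<noteq> {}"
    and cont: "\<And>a b. continuous_on S (\<lambda>p. G p a b)"
    and bil: "\<And>p. p \<in> S \<Longrightarrow> bilinear (G p)"
    and pos: "\<And>p v. p \<in> S \<Longrightarrow> v \<noteq> 0 \<Longrightarrow> G p v v > 0"
  obtains m M where "m > 0" "M > 0"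
    and "\<And>p v. p \<in> S \<Longrightarrow> m * (norm v)\<^sup>2 \<le> G p v v"
    and "\<And>p v. p \<in> S \<Longrightarrow> G p v v \<le> M * (norm v)\<^sup>2"
proof -
  let ?T = "S \<times> sphere (0::'e) 1"
  let ?Q = "\<lambda>z. \<Sum>i\<in>Basis. \<Sum>j\<in>Basis. (snd z \<bullet> i) * (snd z \<bullet> j) * G (fst z) i j"
  have Q: "G p v v = ?Q (p, v)" if "p \<in> S" for p v
  proof -
    have "G p v v = G p (\<Sum>i\<in>Basis. (v \<bullet> i) *\<^sub>R i) (\<Sum>j\<in>Basis. (v \<bullet> j) *\<^sub>R j)"
      by (simp only: euclidean_representation)
    also have "\<dots> = (\<Sum>(i, j)\<in>Basis \<times> Basis. G p ((v \<bullet> i) *\<^sub>R i) ((v \<bullet> j) *\<^sub>R j))"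
      by (rule bilinear_sum[OF bil[OF that]])
    also have "\<dots> = ?Q (p, v)"
      using bil[OF that]
      by (simp add: sum.cartesian_product bilinear_lmul bilinear_rmul mult.assoc)
    finally show ?thesis .
  qed
  have "continuous_on ?T (\<lambda>z. G (fst z) i j)" for i j
    by (rule continuous_on_compose2[OF cont]) (auto intro: continuous_intros)
  then have contQ: "continuous_on ?T ?Q"
    by (intro continuous_intros)
  have T: "compact ?T" "?T \<noteq> {}"
    using assms by (auto intro: compact_Times)
  obtain z where z: "z \<in> ?T" "\<And>y. y \<in> ?T \<Longrightarrow> ?Q z \<le> ?Q y"
    using continuous_attains_inf[OF T contQ] by auto
  obtain z' where z': "z' \<in> ?T" "\<And>y. y \<in> ?T \<Longrightarrow> ?Q y \<le> ?Q z'"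
    using continuous_attains_sup[OF T contQ] by auto
  have posQ: "?Q y > 0" if "y \<in> ?T" for y
  proof -
    have "fst y \<in> S" "snd y \<noteq> 0"
      using that by auto
    then show ?thesis
      using Q[of "fst y" "snd y"] pos[of "fst y" "snd y"] by simp
  qed
  have scale: "G p v v = (norm v)\<^sup>2 * ?Q (p, v /\<^sub>R norm v)" if "p \<in> S" "v \<noteq> 0" for p v
  proof -
    have "G p v v = G p (norm v *\<^sub>R (v /\<^sub>R norm v)) (norm v *\<^sub>R (v /\<^sub>R norm v))"
      using that(2) by (simp only: scaleR_scaleR) simp
    also have "\<dots> = (norm v)\<^sup>2 * G p (v /\<^sub>R norm v) (v /\<^sub>R norm v)"
      by (simp only: bilinear_lmul[OF bil[OF that(1)]] bilinear_rmul[OF bil[OF that(1)]])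
        (simp add: power2_eq_square)
    finally show ?thesis
      by (simp only: Q[OF that(1)])
  qed
  show thesis
  proof
    fix p v assume p: "p \<in> S"
    show "?Q z * (norm v)\<^sup>2 \<le> G p v v"
    proof (cases "v = 0")
      case False
      then have le: "?Q z \<le> ?Q (p, v /\<^sub>R norm v)"
        using p by (intro z(2)) auto
      then show ?thesis
        unfolding scale[OF p False]
        by (subst mult.commute) (rule mult_left_mono[OF le zero_le_power2])
    qed (simp add: bilinear_lzero[OF bil[OF p]])
    show "G p v v \<le> ?Q z' * (norm v)\<^sup>2"
    proof (cases "v = 0")
      case False
      then have le: "?Q (p, v /\<^sub>R norm v) \<le> ?Q z'"
        using p by (intro z'(2)) auto
      then show ?thesis
        unfolding scale[OF p False]
        by (subst (2) mult.commute) (rule mult_left_mono[OF le zero_le_power2])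
    qed (simp add: bilinear_lzero[OF bil[OF p]])
  qed (use posQ z(1) z'(1) in auto)
qed

section \<open>Comparison with the Euclidean norm, operator norms and dual norms\<close>

context fibre_metric
begin

lemma tnorm_equiv_norm:
  obtains m M where "m > 0" "M > 0"
    and "\<And>v. m * norm v \<le> tnorm g (x, v)" "\<And>v. tnorm g (x, v) \<le> M * norm v"
proof -
  \<comment> \<open>A single form is a constant family over a one-point compact set.\<close>
  obtain m M where mM: "m > 0" "M > 0" "\<And>v. m * (norm v)\<^sup>2 \<le> g x v v" "\<And>v. g x v v \<le> M * (norm v)\<^sup>2"
    using form_bounds_on_compact[of "{0::real}" "\<lambda>_. g x"] bilin pos by (simp add: continuous_on_sing) metis
  show thesis
  proof
    fix v
    show "sqrt m * norm v \<le> tnorm g (x, v)" "tnorm g (x, v) \<le> sqrt M * norm v"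
      using real_sqrt_le_mono[OF mM(3)[of v]] real_sqrt_le_mono[OF mM(4)[of v]]
      by (simp_all add: tnorm_def real_sqrt_mult)
  qed (use mM in auto)
qed

lemma linear_tnorm_bound:
  assumes "linear S"
  obtains B where "\<And>v. tnorm g (y, S v) \<le> B * tnorm g (x, v)"
proof -
  obtain m where m: "m > 0" "\<And>v. m * norm v \<le> tnorm g (x, v)"
    using tnorm_equiv_norm[of x] by metis
  obtain M where M: "M > 0" "\<And>v. tnorm g (y, v) \<le> M * norm v"
    using tnorm_equiv_norm[of y] by metis
  obtain L where L: "L > 0" "\<And>v. norm (S v) \<le> L * norm v"
    using linear_bounded_pos[OF assms] by metis
  show thesis
  proof
    fix v
    have "tnorm g (y, S v) \<le> M * (L * norm v)"
      using M(2)[of "S v"] mult_left_mono[OF L(2)[of v], of M] M(1) by linarith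
    also have "\<dots> = M * L / m * (m * norm v)"
      using m(1) by simp
    also have "\<dots> \<le> M * L / m * tnorm g (x, v)"
      by (rule mult_left_mono[OF m(2)]) (use m(1) M(1) L(1) in simp)
    finally show "tnorm g (y, S v) \<le> M * L / m * tnorm g (x, v)" .
  qed
qed

text \<open>A real supremum dominates its members only when the set is bounded above. Linearity in
  finite dimension supplies such a bound, so \<open>restr_onorm\<close> acts as a genuine operator
  norm.\<close>

lemma restr_onorm_bound:
  assumes "linear S" and T: "\<And>v. T (x, v) = (y, S v)" and "v \<in> V"
  shows "tnorm g (y, S v) \<le> restr_onorm g T x V * tnorm g (x, v)"
proof (cases "v = 0")
  case True
  then show ?thesis using linear_0[OF assms(1)] by simp
next
  case False
  obtain B where B: "\<And>v. tnorm g (y, S v) \<le> B * tnorm g (x, v)"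
    using linear_tnorm_bound[OF assms(1)] by metis
  have "bdd_above ((\<lambda>v. tnorm g (T (x, v)) / tnorm g (x, v)) ` V)"
  proof (rule bdd_aboveI2)
    fix v
    \<comment> \<open>\<open>B\<close> comes without a sign, whereas the zero vector contributes the
      quotient 0; hence the maximum with 0.\<close>
    show "tnorm g (T (x, v)) / tnorm g (x, v) \<le> max B 0"
    proof (cases "v = 0")
      case False
      have "tnorm g (y, S v) \<le> max B 0 * tnorm g (x, v)"
        using B[of v] mult_right_mono[of B "max B 0" "tnorm g (x, v)"] by simp
      then show ?thesis
        using tnorm_pos[OF False, of x] by (simp add: T pos_divide_le_eq)
    qed simp
  qed
  then have "tnorm g (T (x, v)) / tnorm g (x, v) \<le> restr_onorm g T x V"
    unfolding restr_onorm_def using \<open>v \<in> V\<close> by (rule cSUP_upper2) simp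
  then show ?thesis
    using tnorm_pos[OF False, of x] by (simp add: T divide_simps)
qed

lemma conorm_bound:
  assumes "linear \<xi>"
  shows "\<xi> w \<le> conorm g (x, \<xi>) * tnorm g (x, w)"
proof (cases "w = 0")
  case True
  then show ?thesis using linear_0[OF assms(1)] by simp
next
  case False
  obtain m where m: "m > 0" "\<And>v. m * norm v \<le> tnorm g (x, v)"
    using tnorm_equiv_norm[of x] by metis
  obtain L where L: "L > 0" "\<And>v. norm (\<xi> v) \<le> L * norm v"
    using linear_bounded_pos[OF assms] by metis
  have "bdd_above ((\<lambda>w. \<xi> w / tnorm g (x, w)) ` (- {0}))"
  proof (rule bdd_aboveI2)
    fix w :: 'e assume "w \<in> - {0}"
    then have w: "tnorm g (x, w) > 0"
      by (simp add: tnorm_pos)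
    have "\<xi> w \<le> L * norm w"
      using L(2)[of w] by simp
    also have "\<dots> = L / m * (m * norm w)"
      using m by simp
    also have "\<dots> \<le> L / m * tnorm g (x, w)"
      by (rule mult_left_mono[OF m(2)]) (use m(1) L(1) in simp)
    finally show "\<xi> w / tnorm g (x, w) \<le> L / m"
      using w by (simp add: pos_divide_le_eq)
  qed
  then have "\<xi> w / tnorm g (x, w) \<le> conorm g (x, \<xi>)"
    unfolding conorm_def prod.case using False by (intro cSUP_upper) auto
  then show ?thesis
    using tnorm_pos[OF False, of x] by (simp add: divide_simps)
qed

lemma conorm_le:
  assumes "\<And>w. \<xi> w \<le> B * tnorm g (x, w)"
  shows "conorm g (x, \<xi>) \<le> B"
proof -
  \<comment> \<open>The supremum can be estimated by an upper bound only over a nonempty set; basis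
    vectors provide nonzero elements.\<close>
  have "- {0::'e} \<noteq> {}"
    using nonzero_Basis by (auto simp: set_eq_iff)
  then show ?thesis
    unfolding conorm_def prod.case
    using assms tnorm_pos by (intro cSUP_least) (auto simp: pos_divide_le_eq)
qed

text \<open>The supremum is over signed values, so the sign needs an argument: the bounds at a basis
  vector \<open>b\<close> and at \<open>- b\<close> have left-hand sides that cancel when
  added.\<close>

lemma conorm_nonneg:
  assumes "linear \<xi>"
  shows "0 \<le> conorm g (x, \<xi>)"
proof -
  obtain b :: 'e where b: "b \<in> Basis"
    using nonempty_Basis by blast
  have "0 \<le> 2 * (conorm g (x, \<xi>) * tnorm g (x, b))"
    using conorm_bound[OF assms, of b x] conorm_bound[OF assms, of "- b" x] linear_neg[OF assms, of b]
    by simp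
  then show ?thesis
    using tnorm_pos[OF nonzero_Basis[OF b], of x] by (simp add: zero_le_mult_iff)
qed

end

section \<open>Projections belonging to a direct sum\<close>

lemma proj_along_eq:
  assumes "direct_sum V W" "v \<in> V" "w \<in> W"
  shows "proj_along V W (v + w) = v"
  unfolding proj_along_def
proof (rule the_equality)
  fix u assume u: "u \<in> V \<and> v + w - u \<in> W"
  have "subspace V" "subspace W" "V \<inter> W = {0}"
    using assms(1) by (auto simp: direct_sum_def)
  have "v - u \<in> V"
    using u assms(2) \<open>subspace V\<close> by (simp add: subspace_diff)
  moreover have "v - u \<in> W"
    using u assms(3) subspace_diff[OF \<open>subspace W\<close>, of "v + w - u" w] by (simp add: algebra_simps)
  ultimately have "v - u \<in> V \<inter> W"
    by blast
  then show "u = v"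
    unfolding \<open>V \<inter> W = {0}\<close> by simp
qed (use assms in simp)

lemma direct_sum_commute: "direct_sum V W \<longleftrightarrow> direct_sum W V"
proof -
  have "{v + w |v w. v \<in> V \<and> w \<in> W} = {v + w |v w. v \<in> W \<and> w \<in> V}"
    using add.commute by blast
  then show ?thesis
    by (auto simp: direct_sum_def Int_commute)
qed

lemma direct_sumE:
  assumes "direct_sum V W"
  obtains v w where "v \<in> V" "w \<in> W" "z = v + w"
proof -
  have "z \<in> {v + w |v w. v \<in> V \<and> w \<in> W}"
    using assms by (simp add: direct_sum_def)
  then show thesis
    using that by blast
qed

lemma linear_proj_along:
  assumes "direct_sum V W"
  shows "linear (proj_along V W)"
proof (rule linearI)
  have sub: "subspace V" "subspace W"
    using assms by (auto simp: direct_sum_def)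
  fix a b :: 'a and r :: real
  obtain v w where a: "v \<in> V" "w \<in> W" "a = v + w"
    using direct_sumE[OF assms] .
  obtain v' w' where b: "v' \<in> V" "w' \<in> W" "b = v' + w'"
    using direct_sumE[OF assms] .
  have "proj_along V W ((v + v') + (w + w')) = v + v'"
    by (rule proj_along_eq[OF assms]) (use a b sub in \<open>auto simp: subspace_add\<close>)
  then show "proj_along V W (a + b) = proj_along V W a + proj_along V W b"
    using a b by (simp add: proj_along_eq[OF assms] algebra_simps)
  have "proj_along V W (r *\<^sub>R v + r *\<^sub>R w) = r *\<^sub>R v"
    by (rule proj_along_eq[OF assms]) (use a sub in \<open>auto simp: subspace_scale\<close>)
  then show "proj_along V W (r *\<^sub>R a) = r *\<^sub>R proj_along V W a"
    using a by (simp add: proj_along_eq[OF assms] scaleR_add_right)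
qed

subsection \<open>Hyperbolic bundle automorphisms\<close>

text \<open>The interface between charts and dynamics: fibrewise linear bijections over a bijection
  of the base, with no topology on the base.\<close>

locale bundle_automorphism = fibre_metric g
  for g :: "'m \<Rightarrow> 'e::euclidean_space \<Rightarrow> 'e \<Rightarrow> real" +
  fixes A :: "('m, 'e) chart set" and f :: "'m \<Rightarrow> 'm"
  assumes bij_f: "bij f"
    and linear_differential: "linear (differential A f x)"
    and bij_differential: "bij (differential A f x)"
begin

abbreviation "F \<equiv> pushforward A f"

text \<open>The derivative cocycle along the orbit of \<open>x\<close>. Separating it from the base
  point makes it a linear bijection of \<open>'e\<close> whose inverse can be used directly.\<close>

definition iter :: "nat \<Rightarrow> 'm \<Rightarrow> 'e \<Rightarrow> 'e" where
  "iter n x v = snd ((F ^^ n) (x, v))"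

lemma pushforward_funpow: "(F ^^ n) (x, v) = ((f ^^ n) x, iter n x v)"
  unfolding iter_def by (induction n) (auto simp: pushforward_def split: prod.splits)

lemma iter_0 [simp]: "iter 0 x = id"
  by (auto simp: iter_def)

lemma iter_Suc: "iter (Suc n) x = differential A f ((f ^^ n) x) \<circ> iter n x"
  by (rule ext) (simp add: iter_def[of "Suc n"] pushforward_funpow, simp add: pushforward_def)

lemma linear_iter: "linear (iter n x)"
proof (induction n)
  case (Suc n)
  then show ?case
    unfolding iter_Suc by (rule linear_compose[OF _ linear_differential])
qed (unfold iter_0, rule linear_id)

lemma bij_iter: "bij (iter n x)"
proof (induction n)
  case (Suc n)
  then show ?case
    unfolding iter_Suc by (rule bij_comp[OF _ bij_differential])
qed (unfold iter_0, rule bij_id)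

lemma linear_inv_iter: "linear (inv (iter n x))"
  using inj_linear_imp_inv_linear[OF linear_iter bij_is_inj[OF bij_iter]] .

lemma inv_iter_iter [simp]: "inv (iter n x) (iter n x v) = v"
  by (simp add: bij_is_inj[OF bij_iter])

lemma iter_inv_iter [simp]: "iter n x (inv (iter n x) v) = v"
  by (simp add: bij_is_surj[OF bij_iter] surj_f_inv_f)

lemma bij_pushforward: "bij F"
proof (rule bijI)
  show "inj F"
    by (auto simp: inj_on_def pushforward_def
        dest!: injD[OF bij_is_inj[OF bij_f]] dest: injD[OF bij_is_inj[OF bij_differential]])
  show "surj F"
  proof (rule surjI)
    fix z :: "'m \<times> 'e"
    show "F (inv f (fst z), inv (differential A f (inv f (fst z))) (snd z)) = z"
      by (simp add: pushforward_def surj_f_inv_f bij_is_surj bij_f bij_differential)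
  qed
qed

text \<open>Taking \<open>(f ^^ n) x\<close> as the starting point makes the inverse iterate land at
  \<open>x\<close>, so no power of \<open>inv f\<close> has to be carried along.\<close>

lemma inv_pushforward_funpow:
  "(inv F ^^ n) ((f ^^ n) x, w) = (x, inv (iter n x) w)"
proof -
  have "(inv F ^^ n) ((F ^^ n) (x, inv (iter n x) w)) = (x, inv (iter n x) w)"
    using inv_fn_o_fn_is_id[OF bij_pushforward, of n] by (metis comp_apply)
  then show ?thesis
    by (simp add: pushforward_funpow)
qed

text \<open>The induction applies the first pullback at the far end of the orbit, which is where
  \<open>iter_Suc\<close> adds its new factor.\<close>

lemma pullback_funpow: "(pullback A f ^^ n) ((f ^^ n) x, \<xi>) = (x, \<xi> \<circ> iter n x)"
proof (induction n arbitrary: \<xi>)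
  case (Suc n)
  have "pullback A f ((f ^^ Suc n) x, \<xi>) = ((f ^^ n) x, \<xi> \<circ> differential A f ((f ^^ n) x))"
    by (simp add: pullback_def bij_is_inj[OF bij_f])
  then show ?case
    using Suc by (simp only: funpow_Suc_right comp_apply) (simp add: iter_Suc comp_assoc)
qed simp

text \<open>Precomposition with a bijection is undone by precomposition with its inverse. This works
  for all functions \<open>'e \<Rightarrow> real\<close>, so \<open>inv\<close> on the whole pair
  type is a two-sided inverse.\<close>

lemma bij_pullback: "bij (pullback A f)"
proof (rule bijI)
  let ?D = "differential A f"
  show "inj (pullback A f)"
  proof (rule injI)
    fix z z' assume eq: "pullback A f z = pullback A f z'"
    obtain y \<eta> y' \<eta>' where z: "z = (y, \<eta>)" "z' = (y', \<eta>')"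
      by (cases z, cases z')
    have "y = y'"
      using eq z bij_is_inj[OF bij_imp_bij_inv[OF bij_f]] by (auto simp: pullback_def inj_eq)
    moreover have "\<eta> \<circ> ?D (inv f y) = \<eta>' \<circ> ?D (inv f y)"
      using eq z \<open>y = y'\<close> by (simp add: pullback_def)
    then have "\<eta> = \<eta>'"
      using bij_is_surj[OF bij_differential] by (metis surj_fun_eq)
    ultimately show "z = z'"
      using z by simp
  qed
  show "surj (pullback A f)"
  proof (rule surjI)
    fix z :: "'m \<times> ('e \<Rightarrow> real)"
    have "inv (?D x) \<circ> ?D x = id" for x
      by (rule inv_o_cancel[OF bij_is_inj[OF bij_differential]])
    then show "pullback A f (f (fst z), snd z \<circ> inv (?D (fst z))) = z"
      by (simp add: pullback_def bij_is_inj[OF bij_f] comp_assoc)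
  qed
qed

lemma inv_pullback_funpow:
  "(inv (pullback A f) ^^ n) (x, \<xi>) = ((f ^^ n) x, \<xi> \<circ> inv (iter n x))"
proof -
  have "(\<xi> \<circ> inv (iter n x)) \<circ> iter n x = \<xi>"
    by auto
  then have "(pullback A f ^^ n) ((f ^^ n) x, \<xi> \<circ> inv (iter n x)) = (x, \<xi>)"
    by (simp only: pullback_funpow)
  then show ?thesis
    using inv_fn_o_fn_is_id[OF bij_pullback, of n] by (metis comp_apply)
qed

end

section \<open>Rates along orbits in \<open>K\<close>, the uniform bound for the splitting, and the
  covector estimate\<close>

locale hyperbolic_bundle = bundle_automorphism g A f
  for g :: "'m \<Rightarrow> 'e::euclidean_space \<Rightarrow> 'e \<Rightarrow> real" and A f +
  fixes K :: "'m set" and Vs Vu :: "'m \<Rightarrow> 'e set" and C l B :: real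
  assumes f_K: "f ` K = K"
    and splitting: "x \<in> K \<Longrightarrow> direct_sum (Vs x) (Vu x)"
    and invariant_s: "x \<in> K \<Longrightarrow> differential A f x ` Vs x = Vs (f x)"
    and invariant_u: "x \<in> K \<Longrightarrow> differential A f x ` Vu x = Vu (f x)"
    and C_pos: "C > 0" and l_pos: "0 < l" and l_less_1: "l < 1" and B_nonneg: "0 \<le> B"
    and rate_u: "x \<in> K \<Longrightarrow> restr_onorm g (inv (pushforward A f) ^^ n) x (Vu x) \<le> C * l ^ n"
    and rate_s: "x \<in> K \<Longrightarrow> restr_onorm g (pushforward A f ^^ n) x (Vs x) \<le> C * l ^ n"
    and differential_bound: "x \<in> K \<Longrightarrow> tnorm g (f x, differential A f x v) \<le> B * tnorm g (x, v)"
begin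

lemma funpow_in_K: "x \<in> K \<Longrightarrow> (f ^^ n) x \<in> K"
  by (induction n) (use f_K in auto)

text \<open>The n-th pullback of a covector at \<open>x\<close> lives over the n-th preimage of
  \<open>x\<close>; the estimates apply there because that point can be found in
  \<open>K\<close>.\<close>

lemma funpow_preimage:
  assumes "x \<in> K"
  obtains y where "y \<in> K" "x = (f ^^ n) y"
proof -
  have "(f ^^ n) ` K = K"
    by (induction n) (simp_all only: funpow.simps image_comp[symmetric] f_K image_id id_apply image_ident)
  then show thesis
    using assms that by blast
qed

lemma iter_in_Vs: "x \<in> K \<Longrightarrow> v \<in> Vs x \<Longrightarrow> iter n x v \<in> Vs ((f ^^ n) x)"
  by (induction n) (use invariant_s[OF funpow_in_K] in \<open>auto simp: iter_Suc\<close>)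

lemma iter_in_Vu: "x \<in> K \<Longrightarrow> v \<in> Vu x \<Longrightarrow> iter n x v \<in> Vu ((f ^^ n) x)"
  by (induction n) (use invariant_u[OF funpow_in_K] in \<open>auto simp: iter_Suc\<close>)

lemma contraction_Vs:
  assumes "x \<in> K" "v \<in> Vs x"
  shows "tnorm g ((f ^^ n) x, iter n x v) \<le> C * l ^ n * tnorm g (x, v)"
proof -
  have "tnorm g ((f ^^ n) x, iter n x v) \<le> restr_onorm g (F ^^ n) x (Vs x) * tnorm g (x, v)"
    using linear_iter pushforward_funpow assms(2) by (rule restr_onorm_bound)
  also have "\<dots> \<le> C * l ^ n * tnorm g (x, v)"
    using rate_s[OF assms(1)] by (rule mult_right_mono) simp
  finally show ?thesis .
qed

text \<open>The backward rate is used at the endpoint \<open>(f ^^ n) x\<close> on the vector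
  \<open>iter n x v\<close>, which invariance keeps unstable and whose inverse iterate is
  \<open>v\<close>.\<close>

lemma expansion_Vu:
  assumes "x \<in> K" "v \<in> Vu x"
  shows "tnorm g (x, v) \<le> C * l ^ n * tnorm g ((f ^^ n) x, iter n x v)"
proof -
  have "tnorm g (x, inv (iter n x) (iter n x v))
      \<le> restr_onorm g (inv F ^^ n) ((f ^^ n) x) (Vu ((f ^^ n) x)) * tnorm g ((f ^^ n) x, iter n x v)"
    using linear_inv_iter inv_pushforward_funpow iter_in_Vu[OF assms] by (rule restr_onorm_bound)
  also have "\<dots> \<le> C * l ^ n * tnorm g ((f ^^ n) x, iter n x v)"
    using rate_u[OF funpow_in_K[OF assms(1)]] by (rule mult_right_mono) simp
  finally show ?thesis by simp
qed

lemma iter_bound: "x \<in> K \<Longrightarrow> tnorm g ((f ^^ n) x, iter n x v) \<le> B ^ n * tnorm g (x, v)"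
proof (induction n)
  case (Suc n)
  have "tnorm g ((f ^^ Suc n) x, iter (Suc n) x v) \<le> B * tnorm g ((f ^^ n) x, iter n x v)"
    using differential_bound[OF funpow_in_K[OF Suc.prems]] by (simp add: iter_Suc)
  also have "\<dots> \<le> B * (B ^ n * tnorm g (x, v))"
    using Suc B_nonneg by (simp add: mult_left_mono)
  finally show ?case by (simp add: mult.assoc)
qed simp

text \<open>Take \<open>N\<close> with \<open>C * l ^ N \<le> 1 / 2\<close>: the N-th iterate at
  least doubles unstable vectors and at least halves stable ones, while it stretches
  \<open>v + w\<close> by at most \<open>B ^ N\<close>. If \<open>v + w\<close> were much shorter
  than \<open>v\<close>, then \<open>v\<close> and \<open>w\<close> would have comparable lengths,
  but their images could not cancel. \<open>N\<close> depends only on \<open>C\<close> and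
  \<open>l\<close>, so the bound is uniform over \<open>K\<close>.\<close>

lemma splitting_bound:
  obtains M where "M > 0"
    and "\<And>x v w. x \<in> K \<Longrightarrow> v \<in> Vu x \<Longrightarrow> w \<in> Vs x \<Longrightarrow> tnorm g (x, v) \<le> M * tnorm g (x, v + w)"
    and "\<And>x v w. x \<in> K \<Longrightarrow> v \<in> Vu x \<Longrightarrow> w \<in> Vs x \<Longrightarrow> tnorm g (x, w) \<le> M * tnorm g (x, v + w)"
proof -
  obtain N where "l ^ N < 1 / (2 * C)"
    using real_arch_pow_inv[of "1 / (2 * C)" l] C_pos l_less_1 by auto
  then have N: "C * l ^ N \<le> 1 / 2"
    using C_pos by (simp add: field_simps)
  have *: "tnorm g (x, v) \<le> (B ^ N + 1) * tnorm g (x, v + w)"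
    if "x \<in> K" "v \<in> Vu x" "w \<in> Vs x" for x v w
  proof -
    let ?t = "\<lambda>u. tnorm g (x, u)" and ?T = "\<lambda>u. tnorm g ((f ^^ N) x, iter N x u)"
    have "?T v - ?T w \<le> ?T (v + w)"
      using tnorm_diff by (simp add: linear_add[OF linear_iter])
    moreover have "?T (v + w) \<le> B ^ N * ?t (v + w)"
      by (rule iter_bound[OF that(1)])
    moreover have "?t v \<le> 1 / 2 * ?T v"
      using expansion_Vu[OF that(1,2), of N] mult_right_mono[OF N tnorm_nonneg] by (rule order_trans)
    moreover have "?T w \<le> 1 / 2 * ?t w"
      using contraction_Vs[OF that(1,3), of N] mult_right_mono[OF N tnorm_nonneg] by (rule order_trans)
    moreover have "?t w \<le> ?t (v + w) + ?t v"
      using tnorm_diff[of x w v] by (simp add: add.commute)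
    \<comment> \<open>The chain is \<open>2 * ?t v \<le> ?T v \<le> ?T w + ?T (v + w)\<close>, with
      \<open>?T w\<close> at most half of \<open>?t (v + w) + ?t v\<close>; doubling and absorbing
      \<open>?t v\<close> on the left gives the factor 3.\<close>
    ultimately have "3 * ?t v \<le> 2 * (B ^ N * ?t (v + w)) + ?t (v + w)"
      by linarith
    then show ?thesis
      using mult_nonneg_nonneg[OF zero_le_power[OF B_nonneg, of N] tnorm_nonneg[of x "v + w"]]
        tnorm_nonneg[of x "v + w"] unfolding distrib_right by linarith
  qed
  show thesis
  proof
    \<comment> \<open>One constant for both components: the stable one is at most the sum plus the
      unstable one, which adds 1 to \<open>B ^ N + 1\<close>.\<close>
    show "B ^ N + 2 > 0"
      using zero_le_power[OF B_nonneg, of N] by linarith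
    fix x v w assume xvw: "x \<in> K" "v \<in> Vu x" "w \<in> Vs x"
    show "tnorm g (x, v) \<le> (B ^ N + 2) * tnorm g (x, v + w)"
      using *[OF xvw] tnorm_nonneg[of x "v + w"] unfolding distrib_right by linarith
    show "tnorm g (x, w) \<le> (B ^ N + 2) * tnorm g (x, v + w)"
      using *[OF xvw] tnorm_diff[of x w v] unfolding distrib_right by (simp add: add.commute)
  qed
qed

text \<open>A covector \<open>\<xi>\<close> composed with a projection sees one component only, and
  the iterates respect the splitting. The rate then contracts that component with factor
  \<open>C * l ^ n\<close>, and \<open>splitting_bound\<close> compares it with the whole vector at
  the cost of \<open>M\<close>; hence the constant \<open>C * M\<close>.\<close>

theorem covector_contraction:
  obtains M where "M > 0"
    and "\<And>x \<eta> n. x \<in> K \<Longrightarrow> linear \<eta> \<Longrightarrow>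
      conorm g ((inv (pullback A f) ^^ n) (x, \<eta> \<circ> proj_along (Vu x) (Vs x)))
        \<le> M * l ^ n * conorm g (x, \<eta> \<circ> proj_along (Vu x) (Vs x))"
    and "\<And>x \<eta> n. x \<in> K \<Longrightarrow> linear \<eta> \<Longrightarrow>
      conorm g ((pullback A f ^^ n) (x, \<eta> \<circ> proj_along (Vs x) (Vu x)))
        \<le> M * l ^ n * conorm g (x, \<eta> \<circ> proj_along (Vs x) (Vu x))"
proof -
  obtain M where M: "M > 0"
    "\<And>x v w. x \<in> K \<Longrightarrow> v \<in> Vu x \<Longrightarrow> w \<in> Vs x \<Longrightarrow> tnorm g (x, v) \<le> M * tnorm g (x, v + w)"
    "\<And>x v w. x \<in> K \<Longrightarrow> v \<in> Vu x \<Longrightarrow> w \<in> Vs x \<Longrightarrow> tnorm g (x, w) \<le> M * tnorm g (x, v + w)"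
    using splitting_bound by blast
  have Cl: "0 \<le> C * l ^ n" for n
    using C_pos l_pos by simp
  show thesis
  proof
    show "C * M > 0"
      using C_pos M(1) by simp
    fix x n and \<eta> :: "'e \<Rightarrow> real" assume x: "x \<in> K" and \<eta>: "linear \<eta>"
    note us = splitting[OF x, unfolded direct_sum_commute[of "Vs x"]] and su = splitting[OF x]
    show "conorm g ((inv (pullback A f) ^^ n) (x, \<eta> \<circ> proj_along (Vu x) (Vs x)))
        \<le> C * M * l ^ n * conorm g (x, \<eta> \<circ> proj_along (Vu x) (Vs x))"
    proof -
      define \<xi> where "\<xi> = \<eta> \<circ> proj_along (Vu x) (Vs x)"
      have \<xi>: "linear \<xi>"
        unfolding \<xi>_def by (rule linear_compose[OF linear_proj_along[OF us] \<eta>])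
      have "(\<xi> \<circ> inv (iter n x)) w \<le> C * M * l ^ n * conorm g (x, \<xi>) * tnorm g ((f ^^ n) x, w)" for w
      proof -
        \<comment> \<open>The preimage of \<open>w\<close> is split at \<open>x\<close>; by
          invariance the images of the parts are the components of \<open>w\<close> at
          \<open>(f ^^ n) x\<close>, which is where \<open>M\<close> is applied.\<close>
        obtain v v' where v: "v \<in> Vu x" "v' \<in> Vs x" "inv (iter n x) w = v + v'"
          using direct_sumE[OF us] .
        have w: "w = iter n x v + iter n x v'"
          using v(3) iter_inv_iter[of n x w] by (simp add: linear_add[OF linear_iter])
        \<comment> \<open>The projection is evaluated twice, on \<open>v + v'\<close> and on
          \<open>v + 0\<close>, since \<open>\<xi>\<close> itself already contains it.\<close>
        have "(\<xi> \<circ> inv (iter n x)) w = \<xi> v"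
          using v proj_along_eq[OF us v(1,2)] proj_along_eq[OF us v(1), of 0] us
          by (simp add: \<xi>_def direct_sum_def subspace_0)
        also have "\<dots> \<le> conorm g (x, \<xi>) * tnorm g (x, v)"
          by (rule conorm_bound[OF \<xi>])
        also have "\<dots> \<le> conorm g (x, \<xi>) * (C * l ^ n * (M * tnorm g ((f ^^ n) x, w)))"
        proof (rule mult_left_mono[OF order_trans[OF expansion_Vu[OF x v(1), of n]] conorm_nonneg[OF \<xi>]])
          have "tnorm g ((f ^^ n) x, iter n x v) \<le> M * tnorm g ((f ^^ n) x, w)"
            unfolding w using v by (intro M(2) funpow_in_K iter_in_Vu iter_in_Vs x)
          then show "C * l ^ n * tnorm g ((f ^^ n) x, iter n x v)
              \<le> C * l ^ n * (M * tnorm g ((f ^^ n) x, w))"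
            using Cl by (rule mult_left_mono)
        qed
        finally show ?thesis by (simp add: mult_ac)
      qed
      then show ?thesis
        unfolding inv_pullback_funpow \<xi>_def[symmetric] by (rule conorm_le)
    qed
    show "conorm g ((pullback A f ^^ n) (x, \<eta> \<circ> proj_along (Vs x) (Vu x)))
        \<le> C * M * l ^ n * conorm g (x, \<eta> \<circ> proj_along (Vs x) (Vu x))"
    proof -
      define \<xi> where "\<xi> = \<eta> \<circ> proj_along (Vs x) (Vu x)"
      have \<xi>: "linear \<xi>"
        unfolding \<xi>_def by (rule linear_compose[OF linear_proj_along[OF su] \<eta>])
      \<comment> \<open>The pulled-back covector is based at \<open>y\<close>, so here the test
        vector is split at \<open>y\<close>, \<open>M\<close> is applied at \<open>y\<close>, and
        the forward iterate contracts the stable part.\<close>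
      obtain y where y: "y \<in> K" "x = (f ^^ n) y"
        using funpow_preimage[OF x] .
      have "(\<xi> \<circ> iter n y) w \<le> C * M * l ^ n * conorm g (x, \<xi>) * tnorm g (y, w)" for w
      proof -
        obtain v v' where v: "v \<in> Vs y" "v' \<in> Vu y" "w = v + v'"
          using direct_sumE[OF splitting[OF y(1)]] .
        have "iter n y v \<in> Vs x" "iter n y v' \<in> Vu x"
          using v y iter_in_Vs iter_in_Vu by auto
        then have "(\<xi> \<circ> iter n y) w = \<xi> (iter n y v)"
          using proj_along_eq[OF su, of "iter n y v" "iter n y v'"]
            proj_along_eq[OF su, of "iter n y v" 0] su v(3)
          by (simp add: \<xi>_def direct_sum_def subspace_0 linear_add[OF linear_iter])
        also have "\<dots> \<le> conorm g (x, \<xi>) * tnorm g (x, iter n y v)"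
          by (rule conorm_bound[OF \<xi>])
        also have "\<dots> \<le> conorm g (x, \<xi>) * (C * l ^ n * (M * tnorm g (y, w)))"
        proof (rule mult_left_mono[OF _ conorm_nonneg[OF \<xi>]])
          have "tnorm g (y, v) \<le> M * tnorm g (y, w)"
            using M(3)[OF y(1) v(2,1)] v(3) by (simp add: add.commute)
          then show "tnorm g (x, iter n y v) \<le> C * l ^ n * (M * tnorm g (y, w))"
            using contraction_Vs[OF y(1) v(1), of n] mult_left_mono[OF _ Cl] unfolding y(2)
            by (meson order_trans)
        qed
        finally show ?thesis by (simp add: mult_ac)
      qed
      then have "conorm g (y, \<xi> \<circ> iter n y) \<le> C * M * l ^ n * conorm g (x, \<xi>)"
        by (rule conorm_le)
      then show ?thesis
        unfolding \<xi>_def[symmetric] using y(2) pullback_funpow[of n y \<xi>] by simp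
    qed
  qed
qed

end

subsection \<open>The differential in charts\<close>

lemma smooth_on_continuous: "smooth_on S h \<Longrightarrow> continuous_on S h"
  unfolding smooth_on_def by (metis Ck_on.simps(1))

lemma smooth_on_differentiable: "smooth_on S h \<Longrightarrow> x \<in> S \<Longrightarrow> h differentiable at x"
  unfolding smooth_on_def by (metis Ck_on.simps(2))

lemma smooth_on_continuous_derivative:
  "smooth_on S h \<Longrightarrow> continuous_on S (\<lambda>x. frechet_derivative h (at x) v)"
  unfolding smooth_on_def by (metis Ck_on.simps)

text \<open>Smoothness gives continuity of the derivative in one fixed direction at a time. The
  finitely many basis directions are bounded on \<open>Q\<close>, and linearity adds these bounds
  up.\<close>

lemma derivative_bound_on_compact:
  fixes h :: "'a::euclidean_space \<Rightarrow> 'b::real_normed_vector"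
  assumes "smooth_on U h" "compact Q" "Q \<subseteq> U"
  obtains L where "L \<ge> 0" "\<And>p v. p \<in> Q \<Longrightarrow> norm (frechet_derivative h (at p) v) \<le> L * norm v"
proof -
  let ?h = "\<lambda>p. frechet_derivative h (at p)"
  have "\<exists>b. \<forall>p\<in>Q. norm (?h p i) \<le> b" for i
  proof -
    have "continuous_on Q (\<lambda>p. ?h p i)"
      using continuous_on_subset[OF smooth_on_continuous_derivative[OF assms(1)] assms(3)] .
    then have "bounded ((\<lambda>p. ?h p i) ` Q)"
      using assms(2) compact_continuous_image compact_imp_bounded by blast
    then show ?thesis
      by (auto simp: bounded_iff)
  qed
  then obtain b where b: "\<And>i p. p \<in> Q \<Longrightarrow> norm (?h p i) \<le> b i"
    by metis
  show thesis
  proof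
    \<comment> \<open>For empty \<open>Q\<close> the numbers \<open>b i\<close> are unconstrained;
      the absolute values keep the constant nonnegative in that case too.\<close>
    show "(\<Sum>i\<in>Basis. \<bar>b i\<bar>) \<ge> 0"
      by (rule sum_nonneg) simp
    fix p v assume p: "p \<in> Q"
    then have lin: "linear (?h p)"
      using smooth_on_differentiable[OF assms(1), of p] assms(3) linear_frechet_derivative by blast
    have "?h p v = ?h p (\<Sum>i\<in>Basis. (v \<bullet> i) *\<^sub>R i)"
      by (simp only: euclidean_representation)
    also have "\<dots> = (\<Sum>i\<in>Basis. (v \<bullet> i) *\<^sub>R ?h p i)"
      by (simp add: linear_sum[OF lin] linear_scale[OF lin])
    also have "norm \<dots> \<le> (\<Sum>i\<in>Basis. \<bar>b i\<bar> * norm v)"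
    proof (rule sum_norm_le)
      fix i :: 'a assume "i \<in> Basis"
      have "\<bar>v \<bullet> i\<bar> * norm (?h p i) \<le> norm v * \<bar>b i\<bar>"
        using b[OF p, of i] Basis_le_norm[OF \<open>i \<in> Basis\<close>, of v] by (intro mult_mono) auto
      then show "norm ((v \<bullet> i) *\<^sub>R ?h p i) \<le> \<bar>b i\<bar> * norm v"
        by (simp add: mult.commute)
    qed
    finally show "norm (?h p v) \<le> (\<Sum>i\<in>Basis. \<bar>b i\<bar>) * norm v"
      by (simp add: sum_distrib_right)
  qed
qed

text \<open>Generalises both \<open>differential\<close> (preferred charts) and
  \<open>coord_change\<close> (\<open>\<phi> = id\<close>), so that one chain rule covers every
  combination of the two.\<close>

definition chart_derivative ::
    "('m, 'e::euclidean_space) chart \<Rightarrow> ('m, 'e) chart \<Rightarrow> ('m \<Rightarrow> 'm) \<Rightarrow> 'm \<Rightarrow> 'e \<Rightarrow> 'e" where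
  "chart_derivative c d \<phi> x =
     frechet_derivative (chart_map d \<circ> \<phi> \<circ> chart_inv c) (at (chart_map c x))"

lemma differential_eq_chart_derivative:
  "differential A f x = chart_derivative (chart_at A x) (chart_at A (f x)) f x"
  by (simp add: differential_def chart_derivative_def)

lemma coord_change_eq_chart_derivative: "coord_change c d x = chart_derivative c d id x"
  by (simp add: coord_change_def chart_derivative_def)

section \<open>The chain rule for coordinate expressions and its consequences\<close>

locale smooth_manifold =
  fixes A :: "('m::{t2_space, second_countable_topology}, 'e::euclidean_space) chart set"
  assumes atlas: "smooth_atlas A"
begin

lemma homeomorphism_chart:
  "c \<in> A \<Longrightarrow> homeomorphism (chart_dom c) (chart_image c) (chart_map c) (chart_inv c)"
  using atlas by (auto simp: smooth_atlas_def is_chart_def)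

lemma open_chart_dom: "c \<in> A \<Longrightarrow> open (chart_dom c)"
  and open_chart_image: "c \<in> A \<Longrightarrow> open (chart_image c)"
  using atlas by (auto simp: smooth_atlas_def is_chart_def)

lemma chart_inv_map [simp]: "c \<in> A \<Longrightarrow> x \<in> chart_dom c \<Longrightarrow> chart_inv c (chart_map c x) = x"
  using homeomorphism_apply1[OF homeomorphism_chart] .

lemma open_chart_map_image:
  assumes c: "c \<in> A" and "open U" "U \<subseteq> chart_dom c"
  shows "open (chart_map c ` U)"
proof -
  have "chart_map c ` U = chart_image c \<inter> chart_inv c -` U"
    using assms by (force simp: chart_image_def)
  then show ?thesis
    using continuous_open_preimage[OF homeomorphism_cont2[OF homeomorphism_chart[OF c]]
        open_chart_image[OF c] \<open>open U\<close>] by simp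
qed

lemma chart_at_in_atlas [simp]: "chart_at A x \<in> A"
  and in_chart_at [simp]: "x \<in> chart_dom (chart_at A x)"
proof -
  have "\<exists>c. c \<in> A \<and> x \<in> chart_dom c"
    using atlas by (auto simp: smooth_atlas_def set_eq_iff)
  then show "chart_at A x \<in> A" "x \<in> chart_dom (chart_at A x)"
    unfolding chart_at_def by (metis (mono_tags, lifting) someI_ex)+
qed

lemma smooth_map_id: "smooth_map A id"
  using atlas by (simp add: smooth_map_def smooth_atlas_def)

lemma open_chart_overlap:
  assumes "smooth_map A \<phi>" "c \<in> A" "d \<in> A"
  shows "open (chart_dom c \<inter> \<phi> -` chart_dom d)"
proof -
  have "open (\<phi> -` chart_dom d)"
    using assms open_chart_dom by (auto simp: smooth_map_def intro: open_vimage)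
  then show ?thesis
    using assms open_chart_dom by (simp add: open_Int)
qed

lemma has_derivative_chart_derivative:
  assumes "smooth_map A \<phi>" "c \<in> A" "d \<in> A" "x \<in> chart_dom c" "\<phi> x \<in> chart_dom d"
  shows "((chart_map d \<circ> \<phi> \<circ> chart_inv c) has_derivative chart_derivative c d \<phi> x) (at (chart_map c x))"
proof -
  have "chart_map d \<circ> \<phi> \<circ> chart_inv c differentiable at (chart_map c x)"
    by (rule smooth_on_differentiable[of "chart_map c ` (chart_dom c \<inter> \<phi> -` chart_dom d)"])
      (use assms in \<open>auto simp: smooth_map_def\<close>)
  then show ?thesis
    unfolding chart_derivative_def frechet_derivative_works .
qed

text \<open>The chain rule in Euclidean space applies to the composite through \<open>d\<close>.
  That composite agrees with the direct expression on the image of the set where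
  \<open>\<phi>\<close> maps into the domain of \<open>d\<close>; the image is open, so the
  derivatives coincide.\<close>

lemma chart_derivative_comp:
  assumes \<phi>: "smooth_map A \<phi>" and \<psi>: "smooth_map A \<psi>"
    and A: "c \<in> A" "d \<in> A" "e \<in> A"
    and x: "x \<in> chart_dom c" "\<phi> x \<in> chart_dom d" "\<psi> (\<phi> x) \<in> chart_dom e"
  shows "chart_derivative c e (\<psi> \<circ> \<phi>) x = chart_derivative d e \<psi> (\<phi> x) \<circ> chart_derivative c d \<phi> x"
proof -
  let ?U = "chart_dom c \<inter> \<phi> -` chart_dom d"
  have "(chart_map e \<circ> \<psi> \<circ> chart_inv d has_derivative chart_derivative d e \<psi> (\<phi> x))
      (at ((chart_map d \<circ> \<phi> \<circ> chart_inv c) (chart_map c x)))"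
    using has_derivative_chart_derivative[OF \<psi> A(2,3) x(2,3)] A x by simp
  then have "((chart_map e \<circ> \<psi> \<circ> chart_inv d) \<circ> (chart_map d \<circ> \<phi> \<circ> chart_inv c) has_derivative
      chart_derivative d e \<psi> (\<phi> x) \<circ> chart_derivative c d \<phi> x) (at (chart_map c x))"
    by (rule diff_chain_at[OF has_derivative_chart_derivative[OF \<phi> A(1,2) x(1,2)]])
  then have "(chart_map e \<circ> (\<psi> \<circ> \<phi>) \<circ> chart_inv c has_derivative
      chart_derivative d e \<psi> (\<phi> x) \<circ> chart_derivative c d \<phi> x) (at (chart_map c x))"
  proof (rule has_derivative_transform_within_open)
    show "open (chart_map c ` ?U)"
      by (rule open_chart_map_image[OF A(1) open_chart_overlap[OF \<phi> A(1,2)]]) simp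
  qed (use A x in auto)
  then show ?thesis
    unfolding chart_derivative_def[of c e] by (rule frechet_derivative_at[symmetric])
qed

lemma chart_derivative_id:
  assumes "c \<in> A" "x \<in> chart_dom c"
  shows "chart_derivative c c id x = id"
proof -
  have "(id has_derivative id) (at (chart_map c x))"
    by (rule has_derivative_id[unfolded id_def[symmetric]])
  then have "(chart_map c \<circ> id \<circ> chart_inv c has_derivative id) (at (chart_map c x))"
    by (rule has_derivative_transform_within_open[OF _ open_chart_image[OF assms(1)]])
      (use assms in \<open>auto simp: chart_image_def\<close>)
  then show ?thesis
    unfolding chart_derivative_def by (rule frechet_derivative_at[symmetric])
qed

lemma linear_chart_derivative:
  assumes "smooth_map A \<phi>" "c \<in> A" "d \<in> A" "x \<in> chart_dom c" "\<phi> x \<in> chart_dom d"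
  shows "linear (chart_derivative c d \<phi> x)"
  using has_derivative_linear[OF has_derivative_chart_derivative[OF assms]] .

lemma coord_change_inverse:
  assumes "c \<in> A" "d \<in> A" "x \<in> chart_dom c" "x \<in> chart_dom d"
  shows "coord_change d c x (coord_change c d x v) = v"
  using chart_derivative_comp[OF smooth_map_id smooth_map_id, of c d c x] chart_derivative_id[of c x] assms
  by (simp add: coord_change_eq_chart_derivative fun_eq_iff)

lemma linear_coord_change:
  assumes "c \<in> A" "d \<in> A" "x \<in> chart_dom c" "x \<in> chart_dom d"
  shows "linear (coord_change c d x)"
  unfolding coord_change_eq_chart_derivative
  using linear_chart_derivative[OF smooth_map_id] assms by simp

lemma linear_differential: "smooth_map A f \<Longrightarrow> linear (differential A f x)"
  unfolding differential_eq_chart_derivative by (rule linear_chart_derivative) auto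

lemma differential_comp:
  assumes "smooth_map A \<phi>" "smooth_map A \<psi>"
  shows "differential A (\<psi> \<circ> \<phi>) x = differential A \<psi> (\<phi> x) \<circ> differential A \<phi> x"
  using chart_derivative_comp[OF assms, of "chart_at A x" "chart_at A (\<phi> x)" "chart_at A (\<psi> (\<phi> x))" x]
  by (simp add: differential_eq_chart_derivative)

lemma differential_id: "differential A id x = id"
  using chart_derivative_id[of "chart_at A x" x] by (simp add: differential_eq_chart_derivative)

text \<open>The chain rule for \<open>f\<close> and \<open>inv f\<close>, in both orders, exhibits
  the differential of \<open>inv f\<close> as a two-sided inverse.\<close>

lemma bij_differential:
  assumes "smooth_diffeo A f"
  shows "bij (differential A f x)"
proof (rule o_bij)
  have f: "bij f" "smooth_map A f" "smooth_map A (inv f)"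
    using assms by (auto simp: smooth_diffeo_def)
  have "inv f \<circ> f = id" "f \<circ> inv f = id"
    using f(1) by (simp_all add: bij_is_inj bij_is_surj flip: surj_iff)
  then show "differential A (inv f) (f x) \<circ> differential A f x = id"
    "differential A f x \<circ> differential A (inv f) (f x) = id"
    using differential_comp[OF f(2,3), of x] differential_comp[OF f(3,2), of "f x"] f(1)
    by (simp_all add: differential_id bij_is_inj)
qed

text \<open>Both sides factor the derivative of \<open>f\<close> from the preferred chart at
  \<open>x\<close> to \<open>d\<close>, once through the preferred chart at \<open>f x\<close> and
  once through \<open>c\<close>. This replaces preferred charts, which may jump, by fixed
  ones.\<close>

lemma coord_change_differential:
  assumes f: "smooth_map A f" and A: "c \<in> A" "d \<in> A" and x: "x \<in> chart_dom c" "f x \<in> chart_dom d"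
  shows "coord_change (chart_at A (f x)) d (f x) (differential A f x v)
    = chart_derivative c d f x (coord_change (chart_at A x) c x v)"
  using chart_derivative_comp[OF f smooth_map_id, of "chart_at A x" "chart_at A (f x)" d x]
    chart_derivative_comp[OF smooth_map_id f, of "chart_at A x" c d x] A x
  by (simp add: differential_eq_chart_derivative coord_change_eq_chart_derivative fun_eq_iff)

end

section \<open>The metric in charts and boundedness of the differential over compact sets\<close>

locale smooth_riemannian_manifold = smooth_manifold A
  for A :: "('m::{t2_space, second_countable_topology}, 'e::euclidean_space) chart set" +
  fixes g :: "'m \<Rightarrow> 'e \<Rightarrow> 'e \<Rightarrow> real"
  assumes metric: "riemannian_metric A g"

sublocale smooth_riemannian_manifold \<subseteq> fibre_metric g
  using metric by unfold_locales (auto simp: riemannian_metric_def)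

context smooth_riemannian_manifold
begin

text \<open>The coordinate expression of the metric that occurs in \<^const>\<open>riemannian_metric\<close>; unlike \<open>g\<close>
  itself, it depends continuously on the point.\<close>

definition metric_in :: "('m, 'e) chart \<Rightarrow> 'e \<Rightarrow> 'e \<Rightarrow> 'e \<Rightarrow> real" where
  "metric_in c p a b = (let x = chart_inv c p; d = chart_at A x
     in g x (coord_change c d x a) (coord_change c d x b))"

lemma metric_in_eq:
  assumes "c \<in> A" "x \<in> chart_dom c"
  shows "metric_in c (chart_map c x) (coord_change (chart_at A x) c x v) (coord_change (chart_at A x) c x w)
    = g x v w"
  using assms by (simp add: metric_in_def coord_change_inverse)

text \<open>At each point \<open>metric_in\<close> is \<open>g\<close> transported by an invertible
  linear change of coordinates, hence again positive definite; continuity in \<open>p\<close> then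
  permits the compactness argument for forms.\<close>

lemma metric_in_bounds:
  assumes c: "c \<in> A" and Q: "compact Q" "Q \<noteq> {}" "Q \<subseteq> chart_image c"
  obtains m M where "m > 0" "M > 0"
    and "\<And>p a. p \<in> Q \<Longrightarrow> m * (norm a)\<^sup>2 \<le> metric_in c p a a"
    and "\<And>p a. p \<in> Q \<Longrightarrow> metric_in c p a a \<le> M * (norm a)\<^sup>2"
proof (rule form_bounds_on_compact[of Q "metric_in c"])
  show "continuous_on Q (\<lambda>p. metric_in c p a b)" for a b
    using metric c Q(3) unfolding riemannian_metric_def metric_in_def
    by (blast intro: continuous_on_subset smooth_on_continuous)
  fix p assume "p \<in> Q"
  then obtain x where x: "x \<in> chart_dom c" "p = chart_map c x"
    using Q(3) by (auto simp: chart_image_def)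
  let ?T = "coord_change c (chart_at A x) x"
  have eq: "metric_in c p a b = g x (?T a) (?T b)" for a b
    using c x by (simp add: metric_in_def Let_def)
  have lin: "linear ?T"
    by (rule linear_coord_change) (use c x in auto)
  show "bilinear (metric_in c p)"
    unfolding bilinear_def eq
    by (auto intro!: linearI simp: g_simps linear_add[OF lin] linear_scale[OF lin])
  fix a :: 'e assume "a \<noteq> 0"
  then have "?T a \<noteq> 0"
    using coord_change_inverse[of c "chart_at A x" x a] c x
      linear_0[OF linear_coord_change[of "chart_at A x" c x]] by auto
  then show "0 < metric_in c p a a"
    unfolding eq by (rule pos)
qed (use assms that in auto)

text \<open>In fixed charts near \<open>x0\<close> and \<open>f x0\<close> both Riemannian norms are
  comparable to Euclidean ones over compact sets, and the coordinate expression \<open>h\<close> has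
  a bounded derivative there.\<close>

lemma differential_locally_bounded:
  assumes f: "smooth_map A f"
  obtains W B where "open W" "x0 \<in> W" "B \<ge> 0"
    and "\<And>x v. x \<in> W \<Longrightarrow> tnorm g (f x, differential A f x v) \<le> B * tnorm g (x, v)"
proof -
  define c d where "c = chart_at A x0" and "d = chart_at A (f x0)"
  have A: "c \<in> A" "d \<in> A" and x0: "x0 \<in> chart_dom c" "f x0 \<in> chart_dom d"
    by (auto simp: c_def d_def)
  define h where "h = chart_map d \<circ> f \<circ> chart_inv c"
  define U where "U = chart_map c ` (chart_dom c \<inter> f -` chart_dom d)"
  have h: "smooth_on U h"
    using f A by (auto simp: smooth_map_def h_def U_def)
  have "open U" "chart_map c x0 \<in> U"
    unfolding U_def using open_chart_map_image[OF A(1) open_chart_overlap[OF f A]] x0 by auto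
  then obtain r where r: "r > 0" "cball (chart_map c x0) r \<subseteq> U"
    by (meson open_contains_cball)
  \<comment> \<open>The closed ball gives compactness for the constants \<open>L\<close>,
    \<open>m\<close> and, through \<open>h\<close>, \<open>M\<close>; its open interior gives the
    neighbourhood \<open>W\<close>.\<close>
  define Q where "Q = cball (chart_map c x0) r"
  have Q: "compact Q" "Q \<noteq> {}" "Q \<subseteq> U"
    using r by (auto simp: Q_def)
  have "U \<subseteq> chart_image c" "h ` U \<subseteq> chart_image d"
    using A by (auto simp: U_def h_def chart_image_def)
  obtain L where L: "L \<ge> 0" "\<And>p v. p \<in> Q \<Longrightarrow> norm (frechet_derivative h (at p) v) \<le> L * norm v"
    using derivative_bound_on_compact[OF h Q(1,3)] by blast
  obtain m where m: "m > 0" "\<And>p a. p \<in> Q \<Longrightarrow> m * (norm a)\<^sup>2 \<le> metric_in c p a a"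
    using metric_in_bounds[OF A(1) Q(1,2)] Q(3) \<open>U \<subseteq> chart_image c\<close> by (metis order_trans)
  have hQ: "compact (h ` Q)" "h ` Q \<noteq> {}" "h ` Q \<subseteq> chart_image d"
    using compact_continuous_image[OF continuous_on_subset[OF smooth_on_continuous[OF h] Q(3)] Q(1)]
      Q \<open>h ` U \<subseteq> chart_image d\<close> by auto
  obtain M where M: "M > 0" "\<And>p a. p \<in> h ` Q \<Longrightarrow> metric_in d p a a \<le> M * (norm a)\<^sup>2"
    using metric_in_bounds[OF A(2) hQ] by metis
  define W where "W = chart_dom c \<inter> chart_map c -` ball (chart_map c x0) r"
  show thesis
  proof
    show "open W"
      unfolding W_def
      using homeomorphism_cont1[OF homeomorphism_chart[OF A(1)]] open_chart_dom[OF A(1)] open_ball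
      by (rule continuous_open_preimage)
    show "x0 \<in> W"
      using x0 r by (simp add: W_def)
    \<comment> \<open>The estimate is made for squared lengths: \<open>M\<close> bounds the target
      metric from above, \<open>L\<close> the derivative, \<open>m\<close> the source metric from
      below.\<close>
    show "sqrt (M * L\<^sup>2 / m) \<ge> 0"
      using M m by simp
    fix x v assume "x \<in> W"
    then have x: "x \<in> chart_dom c" "chart_map c x \<in> Q"
      by (auto simp: W_def Q_def)
    then have "chart_map c x \<in> U"
      using Q(3) by blast
    then have fx: "f x \<in> chart_dom d"
      using x(1) A(1) unfolding U_def by (metis (no_types, lifting) IntE chart_inv_map imageE vimageE)
    have hx: "h (chart_map c x) = chart_map d (f x)"
      using A x by (simp add: h_def)
    define a where "a = coord_change (chart_at A x) c x v"
    define a' where "a' = frechet_derivative h (at (chart_map c x)) a"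
    have a': "coord_change (chart_at A (f x)) d (f x) (differential A f x v) = a'"
      unfolding a'_def a_def h_def
      by (simp only: coord_change_differential[OF f A x(1) fx] chart_derivative_def)
    have "g (f x) (differential A f x v) (differential A f x v) = metric_in d (chart_map d (f x)) a' a'"
      by (simp only: metric_in_eq[OF A(2) fx] flip: a')
    also have "\<dots> \<le> M * (norm a')\<^sup>2"
      using x by (intro M(2)) (auto simp flip: hx)
    also have "\<dots> \<le> M * (L * norm a)\<^sup>2"
      using L(2)[OF x(2), of a] M(1) by (intro mult_left_mono power_mono) (auto simp: a'_def)
    also have "\<dots> = M * L\<^sup>2 / m * (m * (norm a)\<^sup>2)"
      using m(1) by (simp add: power_mult_distrib)
    also have "\<dots> \<le> M * L\<^sup>2 / m * metric_in c (chart_map c x) a a"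
      by (rule mult_left_mono[OF m(2)[OF x(2)]]) (use M(1) m(1) in simp)
    also have "metric_in c (chart_map c x) a a = g x v v"
      unfolding a_def by (rule metric_in_eq[OF A(1) x(1)])
    finally show "tnorm g (f x, differential A f x v) \<le> sqrt (M * L\<^sup>2 / m) * tnorm g (x, v)"
      unfolding tnorm_def prod.case by (simp only: real_sqrt_mult[symmetric] real_sqrt_le_iff)
  qed
qed

lemma differential_bounded_on_compact:
  assumes f: "smooth_map A f" and "compact K"
  obtains B where "B \<ge> 0"
    and "\<And>x v. x \<in> K \<Longrightarrow> tnorm g (f x, differential A f x v) \<le> B * tnorm g (x, v)"
proof -
  have "\<forall>x0. \<exists>W B. open W \<and> x0 \<in> W \<and> B \<ge> 0 \<and>
      (\<forall>x\<in>W. \<forall>v. tnorm g (f x, differential A f x v) \<le> B * tnorm g (x, v))"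
    using differential_locally_bounded[OF f] by metis
  then obtain W B where WB: "\<And>x0. open (W x0)" "\<And>x0. x0 \<in> W x0" "\<And>x0. B x0 \<ge> 0"
    "\<And>x0 x v. x \<in> W x0 \<Longrightarrow> tnorm g (f x, differential A f x v) \<le> B x0 * tnorm g (x, v)"
    by metis
  obtain D where D: "finite D" "K \<subseteq> (\<Union>x0\<in>D. W x0)"
    using compactE_image[OF \<open>compact K\<close>, of K W] WB(1,2) by (metis UN_I subsetI)
  show thesis
  proof
    \<comment> \<open>The sum of the nonnegative local bounds dominates each of them and also makes
      sense for an empty subcover.\<close>
    show "sum B D \<ge> 0"
      using WB(3) by (simp add: sum_nonneg)
    fix x v assume "x \<in> K"
    then obtain x0 where x0: "x0 \<in> D" "x \<in> W x0"
      using D(2) by blast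
    have "B x0 \<le> sum B D"
      using D(1) x0(1) WB(3) by (simp add: member_le_sum)
    then show "tnorm g (f x, differential A f x v) \<le> sum B D * tnorm g (x, v)"
      using WB(4)[OF x0(2), of v] mult_right_mono[OF _ tnorm_nonneg] by (meson order_trans)
  qed
qed

end

theorem lemma3:
  fixes A :: "('m::{t2_space, second_countable_topology}, 'e::euclidean_space) chart set"
    and g :: "'m \<Rightarrow> 'e \<Rightarrow> 'e \<Rightarrow> real"
    and f :: "'m \<Rightarrow> 'm"
    and K :: "'m set"
    and Vs Vu :: "'m \<Rightarrow> 'e set"
  assumes "smooth_atlas A"
    and "riemannian_metric A g"
    and "smooth_diffeo A f"
    and "compact K"
    and "hyperbolic_splitting A g f K Vs Vu"
    and "attractor f K"
  defines "\<P>u \<equiv> adjoint_at (\<lambda>x. proj_along (Vu x) (Vs x))"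
    and "\<P>s \<equiv> adjoint_at (\<lambda>x. proj_along (Vs x) (Vu x))"
  shows "\<exists>C l. C > 0 \<and> 0 < l \<and> l < 1 \<and>
    (\<forall>x\<in>K. \<forall>\<eta>::'e \<Rightarrow> real. linear \<eta> \<longrightarrow> (\<forall>n.
       conorm g ((inv (pullback A f) ^^ n) (\<P>u (x, \<eta>))) \<le> C * l ^ n * conorm g (\<P>u (x, \<eta>)) \<and>
       conorm g ((pullback A f ^^ n) (\<P>s (x, \<eta>))) \<le> C * l ^ n * conorm g (\<P>s (x, \<eta>))))"
proof -
  interpret smooth_riemannian_manifold A g
    using assms(1,2) by unfold_locales
  have f: "bij f" "smooth_map A f"
    using assms(3) by (auto simp: smooth_diffeo_def)
  \<comment> \<open>Compactness of \<open>K\<close> yields the one-step bound from which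
    \<open>splitting_bound\<close> derives its uniform constant.\<close>
  obtain B where B: "B \<ge> 0"
    "\<And>x v. x \<in> K \<Longrightarrow> tnorm g (f x, differential A f x v) \<le> B * tnorm g (x, v)"
    using differential_bounded_on_compact[OF f(2) assms(4)] by blast
  obtain C l where Cl: "C > 0" "0 < l" "l < 1"
    "\<And>x n. x \<in> K \<Longrightarrow> restr_onorm g (inv (pushforward A f) ^^ n) x (Vu x) \<le> C * l ^ n"
    "\<And>x n. x \<in> K \<Longrightarrow> restr_onorm g (pushforward A f ^^ n) x (Vs x) \<le> C * l ^ n"
    using assms(5) unfolding hyperbolic_splitting_def by metis
  have splitting: "f ` K = K" "\<And>x. x \<in> K \<Longrightarrow> direct_sum (Vs x) (Vu x)"
    "\<And>x. x \<in> K \<Longrightarrow> differential A f x ` Vs x = Vs (f x)"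
    "\<And>x. x \<in> K \<Longrightarrow> differential A f x ` Vu x = Vu (f x)"
    using assms(5) unfolding hyperbolic_splitting_def by blast+
  interpret hyperbolic_bundle g A f K Vs Vu C l B
    by (intro hyperbolic_bundle.intro bundle_automorphism.intro bundle_automorphism_axioms.intro
        hyperbolic_bundle_axioms.intro)
      (fact fibre_metric_axioms f(1) linear_differential[OF f(2)] bij_differential[OF assms(3)] splitting Cl B)+
  \<comment> \<open>The covector rate \<open>l\<close> is the rate of the splitting itself; only the
    multiplicative constant changes.\<close>
  obtain M where "M > 0"
    "\<And>x \<eta> n. x \<in> K \<Longrightarrow> linear \<eta> \<Longrightarrow>
      conorm g ((inv (pullback A f) ^^ n) (x, \<eta> \<circ> proj_along (Vu x) (Vs x)))
        \<le> M * l ^ n * conorm g (x, \<eta> \<circ> proj_along (Vu x) (Vs x))"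
    "\<And>x \<eta> n. x \<in> K \<Longrightarrow> linear \<eta> \<Longrightarrow>
      conorm g ((pullback A f ^^ n) (x, \<eta> \<circ> proj_along (Vs x) (Vu x)))
        \<le> M * l ^ n * conorm g (x, \<eta> \<circ> proj_along (Vs x) (Vu x))"
    using covector_contraction by blast
  then show ?thesis
    using Cl(2,3) unfolding \<P>u_def \<P>s_def adjoint_at_def prod.case by blast
qed

end
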